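(* Let $G$ be a connected semisimple real algebraic group of real rank $k$ with set of simple roots $\Delta=\{\alpha_1,\dots,\alpha_k\}$. Let $\Gamma<G$ be a Zariski dense discrete subgroup such that $\min_{1\le i\le k}\delta_{\Gamma,\alpha_i}<\infty$, and let $$T_\Gamma(v):=\min_{1\le i\le k,\ \delta_{\Gamma,\alpha_i}<\infty}\delta_{\Gamma,\alpha_i}\,\alpha_i(v),\qquad v\in\mathfrak a .$$ Then $$\psi_\Gamma(v)\le T_\Gamma(v)\quad\text{for all } v\in\mathfrak a .$$ Moreover, for each $i$ with $\delta_{\Gamma,\alpha_i}<\infty$, there exists $v_i\in\mathcal L-\{0\}$ such that $\psi_\Gamma(v_i)=T_\Gamma(v_i)=\delta_{\Gamma,\alpha_i}\alpha_i(v_i)$.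
   Context: Let $G$ be a connected semisimple real algebraic group with Lie algebra $\mathfrak g=\mathfrak k\oplus\mathfrak p$ (Cartan decomposition), $K$ the maximal compact subgroup with Lie algebra $\mathfrak k$, $\mathfrak a\subset\mathfrak p$ a maximal abelian subalgebra, $\mathfrak a^+\subset\mathfrak a$ a closed positive Weyl chamber, $k=\dim\mathfrak a$ the real rank of $G$, and $\Delta=\{\alpha_1,\dots,\alpha_k\}$ the set of simple roots of $(\mathfrak g,\mathfrak a^+)$. The Cartan projection $\mu:G\to\mathfrak a^+$ is defined by: $\mu(g)$ is the unique element of $\mathfrak a^+$ with $g\in K\exp(\mu(g))K$. For a Zariski dense discrete subgroup $\Gamma<G$: - The limit cone $\mathcal L\subset\mathfrak a^+$ is the asymptotic cone of $\mu(\Gamma)$, i.e. the set of all limits $\lim t_j\mu(\gamma_j)$ with $t_j>0$, $t_j\to0$, $\gamma_j\in\Gamma$. It is a convex cone with non-empty interior. - The growth indicator function $\psi_\Gamma:\mathfrak a\to\mathbb R\cup\{-\infty\}$: fix any norm $\|\cdot\|$ on $\mathfrak a$. For an open cone $\mathcal C\subset\mathfrak a$ let $\tau_{\mathcal C}$ be the abscissa of convergence (infimum of all $s$ for which the series converges) of $\sum_{\gamma\in\Gamma,\ \mu(\gamma)\in\mathcal C}e^{-s\|\mu(\gamma)\|}$. For $v\ne0$ set $\psi_\Gamma(v)=\|v\|\inf_{\mathcal C\ni v}\tau_{\mathcal C}$, the infimum being over all open cones containing $v$; set $\psi_\Gamma(0)=0$. This does not depend on the norm. - For a non-negative function $f$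 on $\mathfrak a^+$, $\delta_{\Gamma,f}\in[0,\infty]$ denotes the abscissa of convergence of $\sum_{\gamma\in\Gamma}e^{-sf(\mu(\gamma))}$. *)

theory Defs
  imports "HOL-Analysis.Analysis" "HOL-Algebra.Group"
begin

section \<open>Real linear algebraic groups\<close>

definition GL :: "(real^'n^'n) monoid" where
  "GL = \<lparr>carrier = {A. invertible A}, mult = (**), one = mat 1\<rparr>"

lemma group_GL: "group (GL :: (real^'n^'n) monoid)"
proof (rule groupI)
  fix x :: "real^'n^'n" assume "x \<in> carrier GL"
  then obtain y where "x ** y = mat 1" "y ** x = mat 1"
    by (auto simp: GL_def invertible_def)
  then show "\<exists>y\<in>carrier GL. y \<otimes>\<^bsub>GL\<^esub> x = \<one>\<^bsub>GL\<^esub>"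
    by (auto simp: GL_def invertible_def)
qed (auto simp: GL_def invertible_mult matrix_mul_assoc invertible_def[of "mat 1"])

definition algebraic_subgroup :: "(real^'n^'n) set \<Rightarrow> bool" where
  "algebraic_subgroup H \<longleftrightarrow> subgroup H GL \<and>
     (\<exists>P. (\<forall>p\<in>P. real_polynomial_function p) \<and>
          H = {A. invertible A \<and> (\<forall>p\<in>P. p A = 0)})"

text \<open>Zariski density of a subset of \<open>G\<close>, in the Zariski topology of the space of matrices.\<close>

definition Zariski_dense_in :: "(real^'n^'n) set \<Rightarrow> (real^'n^'n) set \<Rightarrow> bool" where
  "Zariski_dense_in S G \<longleftrightarrow> S \<subseteq> G \<and>
     (\<forall>p. real_polynomial_function p \<and> (\<forall>A\<in>S. p A = 0) \<longrightarrow> (\<forall>A\<in>G. p A = 0))"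

section \<open>Lie algebras of matrix groups\<close>

text \<open>The type \<^typ>\<open>real^'n^'n\<close> is not an instance of a normed algebra with respect to matrix
  multiplication, so \<^const>\<open>exp\<close> is not available.\<close>

definition matrix_exp :: "real^'n^'n \<Rightarrow> real^'n^'n" where
  "matrix_exp A = (\<Sum>m. (1 / fact m) *\<^sub>R ((\<lambda>B. A ** B) ^^ m) (mat 1))"

text \<open>For a subgroup that is closed in the group of invertible matrices, this is the tangent
  space at the identity.\<close>

definition lie_algebra :: "(real^'n^'n) set \<Rightarrow> (real^'n^'n) set" where
  "lie_algebra H = {X. \<forall>t::real. matrix_exp (t *\<^sub>R X) \<in> H}"

definition lie_bracket :: "real^'n^'n \<Rightarrow> real^'n^'n \<Rightarrow> real^'n^'n" where
  "lie_bracket X Y = X ** Y - Y ** X"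

definition lie_ideal :: "(real^'n^'n) set \<Rightarrow> (real^'n^'n) set \<Rightarrow> bool" where
  "lie_ideal I \<gg> \<longleftrightarrow> subspace I \<and> I \<subseteq> \<gg> \<and> (\<forall>X\<in>\<gg>. \<forall>Y\<in>I. lie_bracket X Y \<in> I)"

definition derived_algebra :: "(real^'n^'n) set \<Rightarrow> (real^'n^'n) set" where
  "derived_algebra V = span {lie_bracket X Y | X Y. X \<in> V \<and> Y \<in> V}"

definition lie_solvable :: "(real^'n^'n) set \<Rightarrow> bool" where
  "lie_solvable V \<longleftrightarrow> (\<exists>m. (derived_algebra ^^ m) V = {0})"

definition lie_semisimple :: "(real^'n^'n) set \<Rightarrow> bool" where
  "lie_semisimple \<gg> \<longleftrightarrow> (\<forall>I. lie_ideal I \<gg> \<and> lie_solvable I \<longrightarrow> I = {0})"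

text \<open>A connected semisimple real algebraic group is the identity component, in the Euclidean
  topology, of the group of real points of a semisimple algebraic group defined over the reals.\<close>

definition connected_semisimple_real_algebraic_group :: "(real^'n^'n) set \<Rightarrow> bool" where
  "connected_semisimple_real_algebraic_group G \<longleftrightarrow>
     (\<exists>H. algebraic_subgroup H \<and> G = connected_component_set H (mat 1)) \<and>
     lie_semisimple (lie_algebra G)"

text \<open>Trace of an endomorphism of a subspace: the sum of the diagonal entries with respect to
  some (equivalently, any) basis.\<close>

definition trace_on :: "'a::euclidean_space set \<Rightarrow> ('a \<Rightarrow> 'a) \<Rightarrow> real" where
  "trace_on V f = (let B = (SOME B. independent B \<and> span B = V)
                   in \<Sum>b\<in>B. representation B (f b) b)"

definition killing_form :: "(real^'n^'n) set \<Rightarrow> real^'n^'n \<Rightarrow> real^'n^'n \<Rightarrow> real" where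
  "killing_form \<gg> X Y = trace_on \<gg> (\<lambda>Z. lie_bracket X (lie_bracket Y Z))"

text \<open>A Cartan decomposition, described without its involution: the three bracket relations,
  together with the definiteness of the Killing form on the two summands, say exactly that
  \<open>X + Y \<mapsto> X - Y\<close> is a Cartan involution.\<close>

definition cartan_decomposition ::
  "(real^'n^'n) set \<Rightarrow> (real^'n^'n) set \<Rightarrow> (real^'n^'n) set \<Rightarrow> bool" where
  "cartan_decomposition \<gg> \<kk> \<pp> \<longleftrightarrow>
     subspace \<kk> \<and> subspace \<pp> \<and> \<gg> = {X + Y | X Y. X \<in> \<kk> \<and> Y \<in> \<pp>} \<and> \<kk> \<inter> \<pp> = {0} \<and>
     (\<forall>X\<in>\<kk>. \<forall>Y\<in>\<kk>. lie_bracket X Y \<in> \<kk>) \<and>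
     (\<forall>X\<in>\<kk>. \<forall>Y\<in>\<pp>. lie_bracket X Y \<in> \<pp>) \<and>
     (\<forall>X\<in>\<pp>. \<forall>Y\<in>\<pp>. lie_bracket X Y \<in> \<kk>) \<and>
     (\<forall>X\<in>\<kk> - {0}. killing_form \<gg> X X < 0) \<and>
     (\<forall>X\<in>\<pp> - {0}. killing_form \<gg> X X > 0)"

definition maximal_compact_subgroup :: "(real^'n^'n) set \<Rightarrow> (real^'n^'n) set \<Rightarrow> bool" where
  "maximal_compact_subgroup G K \<longleftrightarrow>
     subgroup K GL \<and> K \<subseteq> G \<and> compact K \<and>
     (\<forall>K'. subgroup K' GL \<and> K' \<subseteq> G \<and> compact K' \<and> K \<subseteq> K' \<longrightarrow> K' = K)"

definition abelian_subspace :: "(real^'n^'n) set \<Rightarrow> bool" where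
  "abelian_subspace V \<longleftrightarrow> subspace V \<and> (\<forall>X\<in>V. \<forall>Y\<in>V. lie_bracket X Y = 0)"

definition maximal_abelian_in :: "(real^'n^'n) set \<Rightarrow> (real^'n^'n) set \<Rightarrow> bool" where
  "maximal_abelian_in \<pp> \<aa> \<longleftrightarrow> abelian_subspace \<aa> \<and> \<aa> \<subseteq> \<pp> \<and>
     (\<forall>V. abelian_subspace V \<and> V \<subseteq> \<pp> \<and> \<aa> \<subseteq> V \<longrightarrow> V = \<aa>)"

section \<open>Restricted roots\<close>

text \<open>Linear forms on \<open>\<aa>\<close> are represented by functions that are \<^const>\<open>undefined\<close>
  outside \<open>\<aa>\<close>, so that each form has exactly one representative.\<close>

definition restricted_roots ::
  "(real^'n^'n) set \<Rightarrow> (real^'n^'n) set \<Rightarrow> (real^'n^'n \<Rightarrow> real) set" where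
  "restricted_roots \<gg> \<aa> = {\<alpha>. (\<exists>f. linear f \<and> \<alpha> = restrict f \<aa>) \<and>
     (\<exists>H\<in>\<aa>. \<alpha> H \<noteq> 0) \<and>
     (\<exists>X\<in>\<gg>. X \<noteq> 0 \<and> (\<forall>H\<in>\<aa>. lie_bracket H X = \<alpha> H *\<^sub>R X))}"

text \<open>The connected components of the complement of the root hyperplanes are the open Weyl
  chambers.\<close>

definition closed_weyl_chamber ::
  "(real^'n^'n) set \<Rightarrow> (real^'n^'n) set \<Rightarrow> (real^'n^'n) set \<Rightarrow> bool" where
  "closed_weyl_chamber \<gg> \<aa> W \<longleftrightarrow>
     (\<exists>C \<in> components (\<aa> - (\<Union>\<alpha>\<in>restricted_roots \<gg> \<aa>. {H\<in>\<aa>. \<alpha> H = 0})). W = closure C)"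

definition positive_roots ::
  "(real^'n^'n) set \<Rightarrow> (real^'n^'n) set \<Rightarrow> (real^'n^'n) set \<Rightarrow> (real^'n^'n \<Rightarrow> real) set" where
  "positive_roots \<gg> \<aa> W = {\<alpha> \<in> restricted_roots \<gg> \<aa>. \<forall>H\<in>W. \<alpha> H \<ge> 0}"

definition simple_roots ::
  "(real^'n^'n) set \<Rightarrow> (real^'n^'n) set \<Rightarrow> (real^'n^'n) set \<Rightarrow> (real^'n^'n \<Rightarrow> real) set" where
  "simple_roots \<gg> \<aa> W = {\<alpha> \<in> positive_roots \<gg> \<aa> W.
     \<not> (\<exists>\<beta>\<in>positive_roots \<gg> \<aa> W. \<exists>\<gamma>\<in>positive_roots \<gg> \<aa> W. \<forall>H\<in>\<aa>. \<alpha> H = \<beta> H + \<gamma> H)}"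

section \<open>Cartan projection, limit cone, growth indicator\<close>

text \<open>The equivalence says that \<open>\<mu> g\<close> is the unique element \<open>H\<close> of the Weyl chamber
  \<open>W\<close> with \<open>g \<in> K exp(H) K\<close>; outside \<open>G\<close> the function is unconstrained.\<close>

definition is_cartan_projection ::
  "(real^'n^'n) set \<Rightarrow> (real^'n^'n) set \<Rightarrow> (real^'n^'n) set \<Rightarrow> (real^'n^'n \<Rightarrow> real^'n^'n) \<Rightarrow> bool" where
  "is_cartan_projection G K W \<mu> \<longleftrightarrow>
     (\<forall>g\<in>G. \<forall>H. H = \<mu> g \<longleftrightarrow>
        H \<in> W \<and> g \<in> {a ** matrix_exp H ** b | a b. a \<in> K \<and> b \<in> K})"

definition limit_cone ::
  "(real^'n^'n \<Rightarrow> real^'n^'n) \<Rightarrow> (real^'n^'n) set \<Rightarrow> (real^'n^'n) set" where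
  "limit_cone \<mu> \<Gamma> = {v. \<exists>t \<gamma>. (\<forall>j::nat. t j > 0 \<and> \<gamma> j \<in> \<Gamma>) \<and> t \<longlonglongrightarrow> (0::real) \<and>
                         (\<lambda>j. t j *\<^sub>R \<mu> (\<gamma> j)) \<longlonglongrightarrow> v}"

definition abscissa :: "'a set \<Rightarrow> ('a \<Rightarrow> real) \<Rightarrow> ereal" where
  "abscissa S f = Inf {ereal s | s. (\<lambda>\<gamma>. exp (- s * f \<gamma>)) summable_on S}"

definition critical_exponent ::
  "(real^'n^'n \<Rightarrow> real^'n^'n) \<Rightarrow> (real^'n^'n) set \<Rightarrow> (real^'n^'n \<Rightarrow> real) \<Rightarrow> ereal" where
  "critical_exponent \<mu> \<Gamma> f = abscissa \<Gamma> (\<lambda>\<gamma>. f (\<mu> \<gamma>))"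

definition norm_on :: "'a::real_vector set \<Rightarrow> ('a \<Rightarrow> real) \<Rightarrow> bool" where
  "norm_on V N \<longleftrightarrow>
     (\<forall>x\<in>V. N x \<ge> 0 \<and> (N x = 0 \<longleftrightarrow> x = 0)) \<and>
     (\<forall>x\<in>V. \<forall>c. N (c *\<^sub>R x) = \<bar>c\<bar> * N x) \<and>
     (\<forall>x\<in>V. \<forall>y\<in>V. N (x + y) \<le> N x + N y)"

text \<open>The library's \<^const>\<open>cone\<close> is also closed under multiplication by \<open>0\<close>; the only nonempty
  relatively open such cone is the whole space, hence the strict inequality here.\<close>

definition open_cone_in :: "'a::real_normed_vector set \<Rightarrow> 'a set \<Rightarrow> bool" where
  "open_cone_in V C \<longleftrightarrow> openin (top_of_set V) C \<and> (\<forall>x\<in>C. \<forall>c>0. c *\<^sub>R x \<in> C)"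

definition growth_indicator ::
  "(real^'n^'n) set \<Rightarrow> (real^'n^'n \<Rightarrow> real) \<Rightarrow> (real^'n^'n \<Rightarrow> real^'n^'n) \<Rightarrow> (real^'n^'n) set \<Rightarrow>
   real^'n^'n \<Rightarrow> ereal" where
  "growth_indicator \<aa> N \<mu> \<Gamma> v =
     (if v = 0 then 0
      else ereal (N v) *
        (INF C\<in>{C. open_cone_in \<aa> C \<and> v \<in> C}. abscissa {\<gamma>\<in>\<Gamma>. \<mu> \<gamma> \<in> C} (\<lambda>\<gamma>. N (\<mu> \<gamma>))))"

definition tent_function ::
  "nat \<Rightarrow> (nat \<Rightarrow> real^'n^'n \<Rightarrow> real) \<Rightarrow> (real^'n^'n \<Rightarrow> real^'n^'n) \<Rightarrow> (real^'n^'n) set \<Rightarrow>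
   real^'n^'n \<Rightarrow> ereal" where
  "tent_function k \<alpha> \<mu> \<Gamma> v =
     (MIN i\<in>{i\<in>{1..k}. critical_exponent \<mu> \<Gamma> (\<alpha> i) < \<infinity>}.
        critical_exponent \<mu> \<Gamma> (\<alpha> i) * ereal (\<alpha> i v))"

end

(* For s > \<delta>_{\<Gamma>,f} and s f(v) < s' N(v), the open cone {w. s f(w) < s' N(w)} contains v, and on it
   exp (- s' N) is dominated by exp (- s f); this gives \<psi> \<le> \<delta> f. Conversely, if \<psi>(v) < \<delta> f(v) for every
   nonzero v in the limit cone, then the opposite comparison shows that each such v has an open cone on
   which the series of f converges for some s < \<delta>. A nonzero v outside the limit cone has an open cone
   containing only finitely many \<mu>(\<gamma>), because \<mu> is proper on \<Gamma>. By compactness of the unit sphere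
   of \<aa> finitely many of these cones cover \<aa> - {0}, so the series of f over all of \<Gamma> converges for some
   s < \<delta>, a contradiction. *)

theory Submission
  imports Defs
begin

section \<open>Exponential series and their abscissas of convergence\<close>

lemma summable_on_exp_mono:
  fixes f g :: "'a \<Rightarrow> real"
  assumes "(\<lambda>x. exp (- f x)) summable_on S" "\<And>x. x \<in> T \<Longrightarrow> f x \<le> g x" "T \<subseteq> S"
  shows "(\<lambda>x. exp (- g x)) summable_on T"
proof (rule summable_on_comparison_test)
  show "(\<lambda>x. exp (- f x)) summable_on T"
    using assms(1,3) by (rule summable_on_subset_banach)
qed (use assms(2) in auto)

text \<open>Every term is at least 1, so comparison with the constant 1 bounds the cardinality of
  all finite subsets of \<open>S\<close>.\<close>

lemma finite_if_exp_summable_on: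
  fixes f :: "'a \<Rightarrow> real"
  assumes "(\<lambda>x. exp (- f x)) summable_on S" "\<And>x. x \<in> S \<Longrightarrow> f x \<le> 0"
  shows "finite S"
proof -
  have "(\<lambda>x. exp (- (0::real))) summable_on S"
    using summable_on_exp_mono[OF assms(1), of S "\<lambda>_. 0"] assms(2) by simp
  then have "(\<lambda>x. 1::real) summable_on S" by simp
  then obtain c where c: "((\<lambda>x. 1::real) has_sum c) S" by (auto simp: summable_on_def)
  show "finite S"
  proof (rule ccontr)
    assume "infinite S"
    then obtain F where F: "F \<subseteq> S" "finite F" "card F = nat \<lceil>c\<rceil> + 1"
      by (meson infinite_arbitrarily_large)
    have "sum (\<lambda>x. 1::real) F \<le> c"
      by (rule finite_sum_le_has_sum[OF c]) (use F in auto)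
    then show False using F(3) by (simp; linarith)
  qed
qed

lemma abscissa_le:
  "(\<lambda>x. exp (- s * f x)) summable_on S \<Longrightarrow> abscissa S f \<le> ereal s"
  unfolding abscissa_def by (rule Inf_lower) auto

lemma abscissa_lessE:
  assumes "abscissa S f < t"
  obtains s where "ereal s < t" "(\<lambda>x. exp (- s * f x)) summable_on S"
  using assms unfolding abscissa_def Inf_less_iff by auto

lemma abscissa_finite:
  assumes "finite S"
  shows "abscissa S f = - \<infinity>"
proof -
  have "abscissa S f \<le> ereal s" for s
    by (rule abscissa_le) (use assms in auto)
  then show ?thesis
    using ereal_bot by blast
qed

text \<open>A negative exponent makes every term at least 1, which an infinite set does not allow.
  Together with finiteness from above, this makes a critical exponent a real number instead of
  -\<infinity>.\<close>

lemma abscissa_nonneg: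
  assumes "infinite S" "\<And>x. x \<in> S \<Longrightarrow> f x \<ge> 0"
  shows "abscissa S f \<ge> 0"
proof (rule ccontr)
  assume "\<not> abscissa S f \<ge> 0"
  then obtain s where s: "s < 0" "(\<lambda>x. exp (- s * f x)) summable_on S"
    by (metis abscissa_lessE ereal_less(4) not_le zero_ereal_def less_ereal.simps(1))
  have "finite S"
    by (rule finite_if_exp_summable_on[of "\<lambda>x. s * f x"])
      (use s assms(2) in \<open>auto simp: mult_nonpos_nonneg\<close>)
  then show False using assms(1) by simp
qed

section \<open>Norms and open cones on a subspace\<close>

text \<open>The norm axioms for \<open>N\<close> are available only on \<open>V\<close>. Expanding
  in an orthonormal basis of \<open>V\<close> keeps every partial sum inside \<open>V\<close>, and
  Cauchy-Schwarz bounds the coefficients.\<close>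

lemma norm_on_bounded:
  fixes V :: "'a::euclidean_space set"
  assumes V: "subspace V" and N: "norm_on V N"
  obtains B where "\<And>x. x \<in> V \<Longrightarrow> N x \<le> B * norm x"
proof -
  obtain B where B: "B \<subseteq> V" "pairwise orthogonal B" "\<And>x. x \<in> B \<Longrightarrow> norm x = 1"
      "independent B" "span B = V"
    using orthonormal_basis_subspace[OF V] by metis
  have fin: "finite B" using B(4) by (rule independent_imp_finite)
  have le: "N (\<Sum>b\<in>F. (x \<bullet> b) *\<^sub>R b) \<le> (\<Sum>b\<in>F. \<bar>x \<bullet> b\<bar> * N b)" if "F \<subseteq> B" for x F
  proof -
    have "finite F" using fin that by (rule finite_subset[rotated])
    then show ?thesis using that
    proof (induction F)
      case empty
      have "N 0 = 0" using N V subspace_0 unfolding norm_on_def by blast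
      then show ?case by simp
    next
      case (insert b F)
      have b: "b \<in> V" "(x \<bullet> b) *\<^sub>R b \<in> V" using insert B(1) V by (auto intro: subspace_scale)
      have F: "(\<Sum>b\<in>F. (x \<bullet> b) *\<^sub>R b) \<in> V"
        by (rule subspace_sum[OF V]) (use insert B(1) V in \<open>auto intro!: subspace_scale\<close>)
      have "N ((x \<bullet> b) *\<^sub>R b + (\<Sum>b\<in>F. (x \<bullet> b) *\<^sub>R b)) \<le> N ((x \<bullet> b) *\<^sub>R b) + N (\<Sum>b\<in>F. (x \<bullet> b) *\<^sub>R b)"
        using N b(2) F unfolding norm_on_def by blast
      also have "N ((x \<bullet> b) *\<^sub>R b) = \<bar>x \<bullet> b\<bar> * N b"
        using N b(1) unfolding norm_on_def by blast
      finally show ?case using insert by auto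
    qed
  qed
  have "N x \<le> (\<Sum>b\<in>B. N b) * norm x" if x: "x \<in> V" for x
  proof -
    have "x = (\<Sum>b\<in>B. (x \<bullet> b) *\<^sub>R b)"
      using orthonormal_basis_expand[of B x] B fin x by auto
    then have "N x \<le> (\<Sum>b\<in>B. \<bar>x \<bullet> b\<bar> * N b)" using le[of B x] by simp
    also have "\<dots> \<le> (\<Sum>b\<in>B. norm x * N b)"
    proof (rule sum_mono)
      fix b assume b: "b \<in> B"
      have "\<bar>x \<bullet> b\<bar> \<le> norm x" using Cauchy_Schwarz_ineq2[of x b] B(3)[OF b] by simp
      moreover have "N b \<ge> 0" using N b B(1) unfolding norm_on_def by blast
      ultimately show "\<bar>x \<bullet> b\<bar> * N b \<le> norm x * N b" by (rule mult_right_mono)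
    qed
    finally show ?thesis by (simp add: sum_distrib_left mult.commute)
  qed
  then show thesis using that by blast
qed

lemma continuous_on_norm_on:
  fixes V :: "'a::euclidean_space set"
  assumes V: "subspace V" and N: "norm_on V N"
  shows "continuous_on V N"
proof -
  obtain B where B: "\<And>x. x \<in> V \<Longrightarrow> N x \<le> B * norm x"
    using norm_on_bounded[OF V N] by blast
  \<comment> \<open>The absolute value is taken because the sign of \<open>B\<close> is unknown
    (when \<open>V\<close> is trivial it may be negative), while a Lipschitz constant must be
    nonnegative.\<close>
  have le: "N x - N y \<le> \<bar>B\<bar> * norm (x - y)" if "x \<in> V" "y \<in> V" for x y
  proof -
    have d: "x - y \<in> V" using V that by (rule subspace_diff)
    have "N (y + (x - y)) \<le> N y + N (x - y)" using N that d unfolding norm_on_def by blast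
    moreover have "N (x - y) \<le> \<bar>B\<bar> * norm (x - y)"
      using B[OF d] mult_right_mono[OF abs_ge_self[of B] norm_ge_zero[of "x - y"]] by linarith
    ultimately show ?thesis by simp
  qed
  have "\<bar>B\<bar>-lipschitz_on V N"
  proof (rule lipschitz_onI)
    fix x y assume "x \<in> V" "y \<in> V"
    then show "dist (N x) (N y) \<le> \<bar>B\<bar> * dist x y"
      using le[of x y] le[of y x] by (simp add: dist_norm norm_minus_commute abs_le_iff)
  qed simp
  then show ?thesis by (rule lipschitz_on_continuous_on)
qed

text \<open>Both sides are homogeneous of degree one, and strict inequalities between continuous
  functions are open. On these cones one of the series of \<open>N\<close> and \<open>f\<close>
  dominates the other.\<close>

lemma open_cone_in_halfspace:
  fixes V :: "'a::euclidean_space set"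
  assumes V: "subspace V" and N: "norm_on V N" and f: "linear f"
  shows "open_cone_in V {w\<in>V. a * f w < b * N w}" "open_cone_in V {w\<in>V. a * N w < b * f w}"
proof -
  have c: "continuous_on V N" "continuous_on V f"
    using continuous_on_norm_on[OF V N] linear_continuous_on[OF linear_conv_bounded_linear[THEN iffD1, OF f]]
    by auto
  have s: "c *\<^sub>R x \<in> V" "N (c *\<^sub>R x) = c * N x" "f (c *\<^sub>R x) = c * f x" if "x \<in> V" "c > 0" for c x
    using that V N f by (auto simp: subspace_scale norm_on_def linear_scale)
  have o: "openin (top_of_set V) {w\<in>V. g w < h w}"
    if "continuous_on V g" "continuous_on V h" for g h :: "'a \<Rightarrow> real"
  proof -
    have "{w\<in>V. g w < h w} = V \<inter> (\<lambda>w. h w - g w) -` {0<..}" by auto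
    then show ?thesis
      using continuous_openin_preimage_gen[of V "\<lambda>w. h w - g w" "{0<..}"] that
      by (auto intro: continuous_intros)
  qed
  have m: "a * (c * x) < b * (c * y)" if "a * x < b * y" "c > 0" for c x y :: real
    using mult_strict_left_mono[OF that] by (simp add: algebra_simps)
  have "openin (top_of_set V) {w\<in>V. a * f w < b * N w}"
       "openin (top_of_set V) {w\<in>V. a * N w < b * f w}"
    by (intro o continuous_intros c)+
  then show "open_cone_in V {w\<in>V. a * f w < b * N w}" "open_cone_in V {w\<in>V. a * N w < b * f w}"
    unfolding open_cone_in_def by (simp_all add: s m)
qed

lemma open_cone_in_Int:
  "open_cone_in V C \<Longrightarrow> open_cone_in V D \<Longrightarrow> open_cone_in V (C \<inter> D)"
  unfolding open_cone_in_def by auto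

section \<open>Local comparison of a linear form with the norm, and compactness of
  directions\<close>

text \<open>The strict inequality at \<open>v\<close> persists on an open cone around
  \<open>v\<close>. There \<open>r * f\<close> \<le> \<open>s * f\<close> < \<open>s' * N\<close>
  for a convergent exponent \<open>r\<close> < \<open>s\<close>; the first inequality uses that
  \<open>f\<close> is nonnegative on the points considered.\<close>

lemma abscissa_in_cone_le:
  fixes V :: "'a::euclidean_space set" and m :: "'b \<Rightarrow> 'a"
  assumes V: "subspace V" and N: "norm_on V N" and f: "linear f"
    and v: "v \<in> V" "v \<noteq> 0" and t: "abscissa S (\<lambda>x. f (m x)) < ereal s"
    and fS: "\<And>x. x \<in> S \<Longrightarrow> f (m x) \<ge> 0"
    and s': "s * f v < s' * N v"
  shows "(INF C\<in>{C. open_cone_in V C \<and> v \<in> C}. abscissa {x\<in>S. m x \<in> C} (\<lambda>x. N (m x))) \<le> ereal s'"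
proof -
  let ?C = "{w\<in>V. s * f w < s' * N w}"
  obtain r where r: "r < s" "(\<lambda>x. exp (- r * f (m x))) summable_on S"
    using t by (elim abscissa_lessE) auto
  have "(\<lambda>x. exp (- (s' * N (m x)))) summable_on {x\<in>S. m x \<in> ?C}"
  proof (rule summable_on_exp_mono)
    show "(\<lambda>x. exp (- (r * f (m x)))) summable_on S" using r by simp
    fix x assume x: "x \<in> {x\<in>S. m x \<in> ?C}"
    then have "r * f (m x) \<le> s * f (m x)" using r(1) fS[of x] by (intro mult_right_mono) auto
    then show "r * f (m x) \<le> s' * N (m x)" using x by auto
  qed auto
  then have "abscissa {x\<in>S. m x \<in> ?C} (\<lambda>x. N (m x)) \<le> ereal s'"
    by (intro abscissa_le) simp
  moreover have "open_cone_in V ?C" "v \<in> ?C"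
    using open_cone_in_halfspace[OF V N f] v s' by auto
  ultimately show ?thesis
    by (intro INF_lower2[of ?C]) auto
qed

lemma summable_in_cone:
  fixes V :: "'a::euclidean_space set" and m :: "'b \<Rightarrow> 'a"
  assumes V: "subspace V" and N: "norm_on V N" and f: "linear f"
    and v: "v \<in> V" "v \<noteq> 0"
    and t: "ereal (N v) * (INF C\<in>{C. open_cone_in V C \<and> v \<in> C}. abscissa {x\<in>S. m x \<in> C} (\<lambda>x. N (m x)))
            < ereal (d * f v)"
  obtains C s where "open_cone_in V C" "v \<in> C" "s < d"
    "(\<lambda>x. exp (- s * f (m x))) summable_on {x\<in>S. m x \<in> C}"
proof -
  have Nv: "N v > 0" using N v unfolding norm_on_def by (metis less_eq_real_def)
  have "(INF C\<in>{C. open_cone_in V C \<and> v \<in> C}. abscissa {x\<in>S. m x \<in> C} (\<lambda>x. N (m x)))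
      < ereal (d * f v / N v)"
    using iffD2[OF ereal_less_divide_pos t] Nv by simp
  then obtain C where C: "open_cone_in V C" "v \<in> C"
    "abscissa {x\<in>S. m x \<in> C} (\<lambda>x. N (m x)) < ereal (d * f v / N v)"
    unfolding INF_less_iff by blast
  then obtain r where r: "r < d * f v / N v" "(\<lambda>x. exp (- r * N (m x))) summable_on {x\<in>S. m x \<in> C}"
    by (elim abscissa_lessE) auto
  have rd: "r * N v < d * f v" using r(1) Nv by (simp add: pos_less_divide_eq)
  \<comment> \<open>The slack in \<open>r * N v < d * f v\<close> is used to lower \<open>d\<close>
    strictly. If \<open>f v\<close> is nonpositive, lowering the factor does not decrease the right
    side; otherwise \<open>s\<close> is chosen between \<open>r * N v / f v\<close> and
    \<open>d\<close>.\<close>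
  have "\<exists>s<d. r * N v < s * f v"
  proof (cases "f v \<le> 0")
    case True
    have "d * f v \<le> (d - 1) * f v" using True by (intro mult_right_mono_neg) auto
    then show ?thesis using rd by (intro exI[of _ "d - 1"]) auto
  next
    case False
    then have "r * N v / f v < d" using rd by (simp add: pos_divide_less_eq)
    then obtain s where "r * N v / f v < s" "s < d" using dense by blast
    then show ?thesis using False by (auto simp: pos_divide_less_eq)
  qed
  then obtain s where s: "s < d" "r * N v < s * f v" by blast
  \<comment> \<open>The cone \<open>C\<close> provides convergence of the series of \<open>N\<close>
    at \<open>r\<close>; the second cone provides the domination of the series of \<open>f\<close>
    at \<open>s\<close> by it.\<close>
  let ?C = "C \<inter> {w\<in>V. r * N w < s * f w}"
  have "(\<lambda>x. exp (- (s * f (m x)))) summable_on {x\<in>S. m x \<in> ?C}"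
    by (rule summable_on_exp_mono[of "\<lambda>x. r * N (m x)"]) (use r in auto)
  moreover have "open_cone_in V ?C" "v \<in> ?C"
    using C open_cone_in_halfspace[OF V N f] v s by (auto intro!: open_cone_in_Int)
  ultimately show thesis using that[of ?C s] s(1) by simp
qed

text \<open>Finitely many of the cones cover the unit sphere of \<open>V\<close>, hence all nonzero
  points by scaling. The largest of finitely many exponents below \<open>d\<close> is still below
  \<open>d\<close>, and nonnegativity of \<open>f\<close> allows raising each exponent to it. Points
  with \<open>m x = 0\<close> have no direction and are counted separately.\<close>

lemma summable_if_locally_summable:
  fixes V :: "'a::euclidean_space set" and m :: "'b \<Rightarrow> 'a"
  assumes V: "subspace V" and mV: "\<And>x. x \<in> S \<Longrightarrow> m x \<in> V"
    and fS: "\<And>x. x \<in> S \<Longrightarrow> f (m x) \<ge> (0::real)"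
    and fin: "finite {x\<in>S. m x = 0}"
    and loc: "\<And>v. v \<in> V \<Longrightarrow> v \<noteq> 0 \<Longrightarrow> \<exists>C s. open_cone_in V C \<and> v \<in> C \<and> s < d \<and>
          (\<lambda>x. exp (- s * f (m x))) summable_on {x\<in>S. m x \<in> C}"
  shows "\<exists>s<d. (\<lambda>x. exp (- s * f (m x))) summable_on S"
proof -
  let ?K = "V \<inter> sphere 0 1"
  have K: "compact ?K" using V closed_subspace by (intro closed_Int_compact) auto
  \<comment> \<open>The ambient open set \<open>T\<close> stands in for the relatively open cone, so
    that compactness applies to a cover by open sets.\<close>
  define P where "P v T C s \<longleftrightarrow> open T \<and> v \<in> T \<and> V \<inter> T \<subseteq> C \<and> open_cone_in V C \<and> s < d \<and>
          (\<lambda>x. exp (- s * f (m x))) summable_on {x\<in>S. m x \<in> C}" for v T C and s :: real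
  have "\<forall>v\<in>?K. \<exists>T C s. P v T C s"
  proof
    fix v assume v: "v \<in> ?K"
    then obtain C s where C: "open_cone_in V C" "v \<in> C" "s < d"
      "(\<lambda>x. exp (- s * f (m x))) summable_on {x\<in>S. m x \<in> C}"
      using loc[of v] by force
    then obtain T where "open T" "C = V \<inter> T" unfolding open_cone_in_def openin_open by blast
    then have "P v T C s"
      using C unfolding P_def by auto
    then show "\<exists>T C s. P v T C s" by blast
  qed
  then obtain T C s where "\<And>v. v \<in> ?K \<Longrightarrow> P v (T v) (C v) (s v)"
    by metis
  then have TCs: "open (T v) \<and> v \<in> T v \<and> V \<inter> T v \<subseteq> C v \<and>
      open_cone_in V (C v) \<and> s v < d \<and> (\<lambda>x. exp (- s v * f (m x))) summable_on {x\<in>S. m x \<in> C v}"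
    if "v \<in> ?K" for v
    using that unfolding P_def by blast
  obtain I where I: "I \<subseteq> ?K" "finite I" "?K \<subseteq> (\<Union>v\<in>I. T v)"
    by (rule compactE_image[OF K, of ?K T]) (use TCs in auto)
  \<comment> \<open>The entry \<open>d - 1\<close> keeps the maximum meaningful and below
    \<open>d\<close> when \<open>I\<close> is empty, as happens for trivial
    \<open>V\<close>.\<close>
  define r where "r = Max (insert (d - 1) (s ` I))"
  have r: "r < d" "\<And>v. v \<in> I \<Longrightarrow> s v \<le> r"
  proof -
    have "s v < d" if "v \<in> I" for v
      using TCs[of v] that I(1) by blast
    then show "r < d" unfolding r_def using I(2) by auto
  qed (use I(2) in \<open>auto simp: r_def\<close>)
  let ?h = "\<lambda>x. exp (- (r * f (m x)))"
  have "?h summable_on {x\<in>S. m x \<in> C v}" if "v \<in> I" for v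
  proof (rule summable_on_exp_mono)
    have "v \<in> ?K" using that I(1) by blast
    then show "(\<lambda>x. exp (- (s v * f (m x)))) summable_on {x\<in>S. m x \<in> C v}"
      using TCs by simp
  qed (use r(2)[OF that] fS in \<open>auto intro: mult_right_mono\<close>)
  with I(2) have "?h summable_on (\<Union>v\<in>I. {x\<in>S. m x \<in> C v})"
    by (induction I) (auto intro: summable_on_union)
  then have "?h summable_on {x\<in>S. m x = 0} \<union> (\<Union>v\<in>I. {x\<in>S. m x \<in> C v})"
    using fin by (intro summable_on_union) auto
  moreover have "S \<subseteq> {x\<in>S. m x = 0} \<union> (\<Union>v\<in>I. {x\<in>S. m x \<in> C v})"
  proof
    fix x assume x: "x \<in> S"
    show "x \<in> {x\<in>S. m x = 0} \<union> (\<Union>v\<in>I. {x\<in>S. m x \<in> C v})"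
    proof (cases "m x = 0")
      case False
      let ?u = "(1 / norm (m x)) *\<^sub>R m x"
      have u: "?u \<in> ?K" using False mV[OF x] V by (auto simp: subspace_scale)
      then obtain v where v: "v \<in> I" "?u \<in> T v" using I(3) by blast
      then have "?u \<in> C v" using TCs[of v] I(1) u by blast
      then have "norm (m x) *\<^sub>R ?u \<in> C v"
        using TCs[of v] v(1) I(1) False unfolding open_cone_in_def by (meson subsetD zero_less_norm_iff)
      then show ?thesis using False v(1) x by auto
    qed (use x in auto)
  qed
  ultimately have "?h summable_on S" by (rule summable_on_subset_banach)
  then show ?thesis using r(1) by (intro exI[of _ r]) simp
qed

text \<open>If all cones shrinking to the ray of \<open>v\<close> contained infinitely many points,
  properness would give a point of norm above \<open>j\<close> in the \<open>j\<close>-th one.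
  Rescaled to length \<open>norm v\<close>, these points converge to \<open>v\<close> with factors
  tending to 0, which \<open>lim\<close> excludes.\<close>

lemma finite_cone_outside_limit:
  fixes V :: "'a::euclidean_space set" and m :: "'b \<Rightarrow> 'a"
  assumes V: "subspace V" and v: "v \<in> V" "v \<noteq> 0"
    and proper: "\<And>R. finite {x\<in>S. norm (m x) \<le> R}"
    and lim: "\<And>t g. (\<forall>j::nat. t j > (0::real) \<and> g j \<in> S) \<Longrightarrow> t \<longlonglongrightarrow> 0 \<Longrightarrow>
           (\<lambda>j. t j *\<^sub>R m (g j)) \<longlonglongrightarrow> v \<Longrightarrow> False"
  obtains C where "open_cone_in V C" "v \<in> C" "finite {x\<in>S. m x \<in> C}"
proof -
  \<comment> \<open>A point is rescaled to length \<open>norm v\<close> and compared with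
    \<open>v\<close>. The origin is removed because this rescaling is not continuous there.\<close>
  define C where "C j = {w\<in>V. w \<noteq> 0 \<and> norm ((norm v / norm w) *\<^sub>R w - v) < 1 / real (Suc j)}" for j
  have oc: "open_cone_in V (C j)" for j
  proof -
    have "C j = (V - {0}) \<inter> (\<lambda>w. norm ((norm v / norm w) *\<^sub>R w - v)) -` {..<1 / real (Suc j)}"
      unfolding C_def by auto
    also have "openin (top_of_set (V - {0})) \<dots>"
      by (intro continuous_openin_preimage_gen continuous_intros) auto
    finally have "openin (top_of_set (V - {0})) (C j)" .
    moreover have "openin (top_of_set V) (V - {0})"
      by (metis Diff_eq open_Compl closed_singleton openin_open_Int)
    ultimately have "openin (top_of_set V) (C j)" by (rule openin_trans)
    moreover have "c *\<^sub>R x \<in> C j" if "x \<in> C j" "c > 0" for c x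
      using that V by (auto simp: C_def subspace_scale)
    ultimately show ?thesis unfolding open_cone_in_def by blast
  qed
  have vC: "v \<in> C j" for j using v by (auto simp: C_def)
  show thesis
  proof (rule ccontr)
    assume "\<not> thesis"
    then have inf: "infinite {x\<in>S. m x \<in> C j}" for j using oc vC that by blast
    have "\<exists>x\<in>S. m x \<in> C j \<and> norm (m x) > real j" for j
    proof (rule ccontr)
      assume "\<not> (\<exists>x\<in>S. m x \<in> C j \<and> norm (m x) > real j)"
      then have "{x\<in>S. m x \<in> C j} \<subseteq> {x\<in>S. norm (m x) \<le> real j}" by force
      then show False using inf proper finite_subset by blast
    qed
    then obtain g where g: "\<And>j. g j \<in> S" "\<And>j. m (g j) \<in> C j" "\<And>j. norm (m (g j)) > real j"
      by metis
    define t where "t j = norm v / norm (m (g j))" for j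
    have pos: "t j > 0" for j using v(2) g(3)[of j] unfolding t_def by (intro divide_pos_pos) (auto simp: C_def)
    have t0: "t \<longlonglongrightarrow> 0"
    proof -
      have "filterlim (\<lambda>j. norm (m (g j))) at_top sequentially"
        by (rule filterlim_at_top_mono[OF filterlim_real_sequentially]) (use g(3) in \<open>auto intro!: always_eventually less_imp_le\<close>)
      then show ?thesis unfolding t_def by (rule real_tendsto_divide_at_top[OF tendsto_const])
    qed
    have "(\<lambda>j. t j *\<^sub>R m (g j) - v) \<longlonglongrightarrow> 0"
    proof (rule Lim_null_comparison)
      show "\<forall>\<^sub>F j in sequentially. norm (t j *\<^sub>R m (g j) - v) \<le> inverse (real (Suc j))"
        using g(2) by (auto simp: C_def t_def divide_inverse intro!: always_eventually less_imp_le)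
    qed (rule LIMSEQ_inverse_real_of_nat)
    then have "(\<lambda>j. t j *\<^sub>R m (g j)) \<longlonglongrightarrow> v" by (simp add: LIM_zero_iff)
    with lim[of t g] pos g(1) t0 show False by blast
  qed
qed

section \<open>The matrix exponential and discrete matrix groups\<close>

lemma bounded_bilinear_matrix_mult:
  "bounded_bilinear ((**) :: real^'n^'n \<Rightarrow> real^'n^'n \<Rightarrow> real^'n^'n)"
  unfolding bilinear_conv_bounded_bilinear[symmetric] bilinear_def
proof (intro conjI allI linearI)
  fix A B C :: "real^'n^'n" and c :: real
  show "A ** (B + C) = A ** B + A ** C" by (rule matrix_add_ldistrib)
  show "(B + C) ** A = B ** A + C ** A"
    by (simp add: vec_eq_iff matrix_matrix_mult_def distrib_right sum.distrib)
  show "(c *\<^sub>R B) ** A = c *\<^sub>R (B ** A)" by (simp add: scalar_matrix_assoc)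
  show "A ** (c *\<^sub>R B) = c *\<^sub>R (A ** B)" by (simp add: matrix_scalar_ac scalar_matrix_assoc)
qed

lemma norm_matrix_mult_le:
  obtains B where "B > 0" "\<And>(A :: real^'n^'n) (C :: real^'n^'n). norm (A ** C) \<le> norm A * norm C * B"
proof -
  have "\<exists>B>0. \<forall>(A :: real^'n^'n) (C :: real^'n^'n). norm (A ** C) \<le> norm A * norm C * B"
    by (rule bounded_bilinear.pos_bounded[OF bounded_bilinear_matrix_mult])
  then show thesis using that by auto
qed

text \<open>Weierstrass M-test on a ball. The Euclidean norm on matrices is submultiplicative up to
  a constant \<open>B\<close>, so the majorant is the exponential series at
  \<open>\<bar>R\<bar> * B\<close>, scaled by the norm of the identity.\<close>

lemma continuous_on_matrix_exp:
  "continuous_on (cball 0 R) (matrix_exp :: real^'n^'n \<Rightarrow> real^'n^'n)"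
proof -
  interpret mult: bounded_bilinear "(**) :: real^'n^'n \<Rightarrow> real^'n^'n \<Rightarrow> real^'n^'n"
    by (rule bounded_bilinear_matrix_mult)
  obtain B where B: "B > 0" "\<And>(A :: real^'n^'n) (C :: real^'n^'n). norm (A ** C) \<le> norm A * norm C * B"
    using norm_matrix_mult_le[where 'n='n] by auto
  define p where "p m A = ((\<lambda>C. A ** C) ^^ m) (mat 1)" for m and A :: "real^'n^'n"
  define M where "M m = norm (mat 1 :: real^'n^'n) * (inverse (fact m) * (\<bar>R\<bar> * B) ^ m)" for m
  have p: "norm (p m A) \<le> norm (mat 1 :: real^'n^'n) * (\<bar>R\<bar> * B) ^ m" if "A \<in> cball 0 R" for m A
  proof (induction m)
    case (Suc m)
    have "norm (p (Suc m) A) \<le> norm A * norm (p m A) * B"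
      using B(2)[of A "p m A"] by (simp add: p_def)
    also have "\<dots> \<le> \<bar>R\<bar> * (norm (mat 1 :: real^'n^'n) * (\<bar>R\<bar> * B) ^ m) * B"
      using that B(1) Suc by (intro mult_mono) auto
    finally show ?case by (simp add: algebra_simps)
  qed (simp add: p_def)
  have cont: "continuous_on (cball 0 R) (p m)" for m
    by (induction m) (auto simp: p_def intro!: mult.continuous_on continuous_on_id)
  have "summable M"
    unfolding M_def by (intro summable_mult summable_exp)
  moreover have "norm ((1 / fact m) *\<^sub>R p m A) \<le> M m" if "A \<in> cball 0 R" for m A
    using mult_left_mono[OF p[OF that, of m], of "inverse (fact m)"]
    by (simp add: M_def divide_inverse algebra_simps)
  ultimately have "uniform_limit (cball 0 R) (\<lambda>k A. \<Sum>m<k. (1 / fact m) *\<^sub>R p m A)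
      (\<lambda>A. \<Sum>m. (1 / fact m) *\<^sub>R p m A) sequentially"
    by (intro Weierstrass_m_test) auto
  moreover have "matrix_exp = (\<lambda>A::real^'n^'n. \<Sum>m. (1 / fact m) *\<^sub>R p m A)"
    by (auto simp: matrix_exp_def p_def)
  ultimately show ?thesis
    using cont by (intro uniform_limit_theorem[where F = sequentially])
      (auto intro!: always_eventually continuous_intros)
qed

text \<open>An accumulation point \<open>x\<close> in \<open>Q\<close> is invertible. Two distinct
  elements \<open>g\<close>, \<open>g'\<close> of \<Gamma> close to \<open>x\<close> give a
  nontrivial quotient \<open>h\<close> in \<Gamma> close to the identity, which is isolated in
  \<Gamma>.\<close>

lemma finite_discrete_subgroup_Int_compact:
  fixes \<Gamma> Q :: "(real^'n^'n) set"
  assumes \<Gamma>: "subgroup \<Gamma> GL" "discrete \<Gamma>" and Q: "compact Q" "\<And>A. A \<in> Q \<Longrightarrow> invertible A"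
  shows "finite (\<Gamma> \<inter> Q)"
proof (rule ccontr)
  interpret mult: bounded_bilinear "(**) :: real^'n^'n \<Rightarrow> real^'n^'n \<Rightarrow> real^'n^'n"
    by (rule bounded_bilinear_matrix_mult)
  interpret subgroup \<Gamma> GL by (rule \<Gamma>)
  interpret GL: group "GL :: (real^'n^'n) monoid" by (rule group_GL)
  obtain B where B: "B > 0" "\<And>(A :: real^'n^'n) (C :: real^'n^'n). norm (A ** C) \<le> norm A * norm C * B"
    using norm_matrix_mult_le[where 'n='n] by auto
  assume "infinite (\<Gamma> \<inter> Q)"
  then obtain x where x: "x \<in> Q" "x islimpt (\<Gamma> \<inter> Q)"
    using compact_eq_Bolzano_Weierstrass[THEN iffD1, OF Q(1), rule_format, of "\<Gamma> \<inter> Q"] by auto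
  then obtain y where y: "y ** x = mat 1" using Q(2) unfolding invertible_def by blast
  have "mat 1 \<in> \<Gamma>" using one_closed by (simp add: GL_def)
  then have "mat 1 isolated_in \<Gamma>" using \<Gamma>(2) by (rule discreteD[rotated])
  then obtain e where e: "e > 0" "\<And>h. h \<in> \<Gamma> \<Longrightarrow> dist (mat 1) h < e \<Longrightarrow> h = mat 1"
    unfolding isolated_in_dist_Ex_iff by blast
  \<comment> \<open>The added 1 makes \<open>Y\<close> positive, so it may be divided by. The first
    bound in \<open>r\<close> makes the term with \<open>d\<close> at most \<open>d / 2\<close>, to
    be absorbed on the left; the second makes the remaining term at most \<open>e / 2\<close>. Hence
    \<open>d\<close> < \<open>e\<close>.\<close>
  define Y where "Y = norm y * B + 1"
  have Y: "Y > 0" "norm y * B \<le> Y" unfolding Y_def using B(1) by (auto intro: add_nonneg_pos)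
  define r where "r = min (1 / (2 * Y * B)) (e / (4 * Y))"
  have r: "r > 0" "Y * r * B \<le> 1 / 2" "4 * Y * r \<le> e"
  proof -
    show "r > 0" unfolding r_def using Y B e by auto
    have "r \<le> 1 / (2 * Y * B)" "r \<le> e / (4 * Y)" unfolding r_def by auto
    then show "Y * r * B \<le> 1 / 2" "4 * Y * r \<le> e" using Y B
      by (simp_all add: field_simps)
  qed
  have "infinite (\<Gamma> \<inter> Q \<inter> ball x r)"
    using x(2) r(1) unfolding islimpt_eq_infinite_ball by blast
  then have inf: "infinite (\<Gamma> \<inter> Q \<inter> ball x r - {g})" for g by simp
  obtain g where g1: "g \<in> \<Gamma>" "g \<in> ball x r"
    using infinite_imp_nonempty[OF inf] by blast
  obtain g' where "g' \<in> \<Gamma>" "g' \<in> ball x r" "g \<noteq> g'"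
    using infinite_imp_nonempty[OF inf[of g]] by blast
  note g = g1(1) this(1) g1(2) this(2,3)
  define h where "h = inv\<^bsub>GL\<^esub> g \<otimes>\<^bsub>GL\<^esub> g'"
  have h: "h \<in> \<Gamma>" unfolding h_def using g by auto
  have "g \<otimes>\<^bsub>GL\<^esub> h = g'" unfolding h_def
    using g(1,2) subset by (simp add: GL.m_assoc[symmetric] subsetD)
  then have gh: "g ** h = g'" by (simp add: GL_def)
  define d where "d = norm (h - mat 1)"
  have "h \<noteq> mat 1" using gh g(5) by auto
  then have "d \<ge> e" using e(2)[OF h] unfolding d_def by (force simp: dist_norm norm_minus_commute)
  \<comment> \<open>\<open>h - 1 = y ((x - g) (h - 1) + (g' - g))\<close> makes \<open>h\<close> close to \<open>1\<close> without an estimate on inverses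
    of elements near \<open>x\<close>.\<close>
  have "h - mat 1 = y ** (x ** (h - mat 1))" by (simp add: matrix_mul_assoc y)
  also have "x ** (h - mat 1) = (x - g) ** (h - mat 1) + (g' - g)"
    by (simp add: mult.diff_left mult.diff_right gh)
  finally have "d = norm (y ** ((x - g) ** (h - mat 1) + (g' - g)))" unfolding d_def by simp
  also have "\<dots> \<le> norm y * norm ((x - g) ** (h - mat 1) + (g' - g)) * B" by (rule B)
  also have "\<dots> \<le> Y * norm ((x - g) ** (h - mat 1) + (g' - g))"
    using mult_right_mono[OF Y(2) norm_ge_zero, of "(x - g) ** (h - mat 1) + (g' - g)"]
    by (simp add: mult.commute mult.left_commute)
  also have "\<dots> < Y * (r * d * B + 2 * r)"
  proof (intro mult_strict_left_mono Y)
    have "norm ((x - g) ** (h - mat 1)) \<le> norm (x - g) * d * B"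
      unfolding d_def by (rule B)
    also have "\<dots> \<le> r * d * B"
      using g(3) B(1) by (intro mult_right_mono) (auto simp: dist_norm d_def)
    finally have "norm ((x - g) ** (h - mat 1)) \<le> r * d * B" .
    moreover have "norm (g' - g) < 2 * r"
      using g(3,4) norm_triangle_ineq[of "g' - x" "x - g"] by (auto simp: dist_norm norm_minus_commute)
    ultimately show "norm ((x - g) ** (h - mat 1) + (g' - g)) < r * d * B + 2 * r"
      using norm_triangle_ineq[of "(x - g) ** (h - mat 1)" "g' - g"] by linarith
  qed
  also have "\<dots> = (Y * r * B) * d + 2 * Y * r" by (simp add: algebra_simps)
  also have "\<dots> \<le> d / 2 + e / 2"
    using r(2,3) mult_right_mono[OF r(2), of d] by (simp add: d_def)
  finally show False using \<open>d \<ge> e\<close> by simp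
qed

section \<open>Infinitude of a Zariski dense subgroup\<close>

text \<open>A finite set is Zariski closed over the reals: the product of the squared distances to
  its points is a polynomial vanishing exactly on it.\<close>

lemma Zariski_dense_finite:
  fixes S :: "(real^'n^'n) set"
  assumes "finite S" "Zariski_dense_in S G"
  shows "G = S"
proof -
  define p where "p A = (\<Prod>B\<in>S. (A - B) \<bullet> (A - B))" for A :: "real^'n^'n"
  have lin: "real_polynomial_function (\<lambda>A. (A - B) \<bullet> (A - B))" for B :: "real^'n^'n"
  proof -
    have "(\<lambda>A. (A - B) \<bullet> (A - B)) = (\<lambda>A. \<Sum>b\<in>Basis. (A \<bullet> b - B \<bullet> b) * (A \<bullet> b - B \<bullet> b))"
      using euclidean_inner[of "_ - B" "_ - B"] by (simp add: inner_diff_left[of _ B])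
    moreover have "real_polynomial_function (\<lambda>A::real^'n^'n. A \<bullet> b - B \<bullet> b)" for b
      by (intro real_polynomial_function_diff real_polynomial_function.intros bounded_linear_inner_left)
    ultimately show ?thesis
      by (simp add: real_polynomial_function_sum real_polynomial_function.intros(4))
  qed
  have "real_polynomial_function p"
    unfolding p_def using assms(1) lin by (intro real_polynomial_function_prod) auto
  moreover have p0: "p A = 0 \<longleftrightarrow> A \<in> S" for A
    unfolding p_def using assms(1) by auto
  ultimately show ?thesis
    using assms(2) unfolding Zariski_dense_in_def by blast
qed

lemma weyl_chamber_subset:
  assumes \<aa>: "subspace \<aa>" and W: "closed_weyl_chamber \<gg> \<aa> W"
  shows "W \<subseteq> \<aa>"
proof -
  obtain C where C: "C \<in> components (\<aa> - (\<Union>\<alpha>\<in>restricted_roots \<gg> \<aa>. {H\<in>\<aa>. \<alpha> H = 0}))" "W = closure C"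
    using W unfolding closed_weyl_chamber_def by blast
  then show ?thesis
    using in_components_subset[OF C(1)] closure_minimal[of C \<aa>] closed_subspace[OF \<aa>] by auto
qed

text \<open>Positive scaling preserves nonvanishing of the roots, so the open ray through a point of
  an open chamber is a connected subset of the complement and stays in that chamber. The root
  \<beta> excludes the origin, so the ray is infinite.\<close>

lemma infinite_weyl_chamber:
  assumes \<aa>: "subspace \<aa>" and \<beta>: "\<beta> \<in> restricted_roots \<gg> \<aa>"
    and W: "closed_weyl_chamber \<gg> \<aa> W"
  shows "infinite W"
proof -
  let ?U = "\<aa> - (\<Union>\<alpha>\<in>restricted_roots \<gg> \<aa>. {H\<in>\<aa>. \<alpha> H = 0})"
  obtain C where C: "C \<in> components ?U" "W = closure C"
    using W unfolding closed_weyl_chamber_def by blast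
  have scale: "\<alpha> (t *\<^sub>R H) = t * \<alpha> H" if "\<alpha> \<in> restricted_roots \<gg> \<aa>" "H \<in> \<aa>" for \<alpha> H and t :: real
    using that \<aa> unfolding restricted_roots_def
    by (auto simp: subspace_scale linear_scale)
  obtain H where H: "H \<in> C" using in_components_nonempty[OF C(1)] by blast
  then have HU: "H \<in> ?U" using in_components_subset[OF C(1)] by blast
  have H0: "H \<noteq> 0"
  proof
    assume "H = 0"
    then have "\<beta> H = 0" using scale[OF \<beta>, of 0 0] \<aa> by (simp add: subspace_0)
    then show False using HU \<beta> by blast
  qed
  let ?R = "(\<lambda>t. t *\<^sub>R H) ` {0<..}"
  have "connected ?R"
    by (intro connected_continuous_image continuous_intros) auto
  moreover have "?R \<subseteq> ?U"
    using HU \<aa> by (auto simp: scale subspace_scale)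
  moreover have "H \<in> ?R \<inter> C" using H by (auto intro!: image_eqI[of _ _ 1])
  ultimately have "?R \<subseteq> C"
    using components_maximal[OF C(1)] by blast
  then have "?R \<subseteq> W" using C(2) closure_subset by blast
  moreover have "infinite ?R"
    using H0 by (subst finite_image_iff) (auto simp: inj_on_def infinite_Ioi)
  ultimately show "infinite W" using finite_subset by blast
qed

text \<open>A finite \<Gamma> would be all of \<open>G\<close>, whereas the image of
  \<open>G\<close> under \<mu> contains the infinite set \<open>W\<close>.\<close>

lemma infinite_if_Zariski_dense:
  assumes "is_cartan_projection G K W \<mu>" "mat 1 \<in> K" "W \<subseteq> lie_algebra G"
    and "infinite W" "Zariski_dense_in \<Gamma> G"
  shows "infinite \<Gamma>"
proof
  assume "finite \<Gamma>"
  then have "finite G" using Zariski_dense_finite assms(5) by metis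
  \<comment> \<open>Uniqueness of the Cartan projection gives \<open>\<mu> (exp H) = H\<close> for \<open>H \<in> W\<close>.\<close>
  have "W \<subseteq> \<mu> ` G"
  proof
    fix H assume H: "H \<in> W"
    then have "matrix_exp (1 *\<^sub>R H) \<in> G" using assms(3) unfolding lie_algebra_def by blast
    then have "matrix_exp H \<in> G" by simp
    moreover have "matrix_exp H = mat 1 ** matrix_exp H ** mat 1" by simp
    then have "matrix_exp H \<in> {a ** matrix_exp H ** b | a b. a \<in> K \<and> b \<in> K}"
      using assms(2) by blast
    ultimately have "H = \<mu> (matrix_exp H)"
      using assms(1) H unfolding is_cartan_projection_def by blast
    then show "H \<in> \<mu> ` G" using \<open>matrix_exp H \<in> G\<close> by blast
  qed
  then show False using \<open>finite G\<close> assms(4) finite_surj by blast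
qed

section \<open>Properness of the Cartan projection\<close>

text \<open>The elements in question lie in the product of \<open>K\<close>, the exponential of a
  compact piece of \<open>W\<close>, and \<open>K\<close>. This is compact and consists of
  invertible matrices, so a discrete subgroup meets it in a finite set.\<close>

lemma cartan_projection_proper:
  assumes \<mu>: "is_cartan_projection G K W \<mu>" and K: "subgroup K GL" "compact K"
    and W: "closed W" "W \<subseteq> lie_algebra G" and G: "\<And>A. A \<in> G \<Longrightarrow> invertible A"
    and \<Gamma>: "subgroup \<Gamma> GL" "discrete \<Gamma>" "\<Gamma> \<subseteq> G"
  shows "finite {g\<in>\<Gamma>. norm (\<mu> g) \<le> R}"
proof -
  interpret mult: bounded_bilinear "(**) :: real^'n^'n \<Rightarrow> real^'n^'n \<Rightarrow> real^'n^'n"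
    by (rule bounded_bilinear_matrix_mult)
  let ?E = "matrix_exp ` (W \<inter> cball 0 R)"
  define Q where "Q = (\<lambda>(a, c, b). a ** c ** b) ` (K \<times> ?E \<times> K)"
  have "compact ?E"
    using W(1) by (intro compact_continuous_image continuous_on_subset[OF continuous_on_matrix_exp])
      (auto intro: closed_Int_compact)
  then have "compact Q"
    unfolding Q_def case_prod_beta using K(2)
    by (intro compact_continuous_image[of "K \<times> ?E \<times> K"] mult.continuous_on compact_Times continuous_intros)
  moreover have "invertible A" if AQ: "A \<in> Q" for A
  proof -
    obtain a H b where A: "A = a ** matrix_exp H ** b" "a \<in> K" "H \<in> W" "b \<in> K"
      using AQ unfolding Q_def by (auto intro: that)
    have "matrix_exp (1 *\<^sub>R H) \<in> G" using A(3) W(2) unfolding lie_algebra_def by blast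
    moreover have "invertible a" "invertible b"
      using A K(1) subgroup.subset[OF K(1)] by (auto simp: GL_def)
    ultimately show ?thesis using A(1) G by (simp add: invertible_mult)
  qed
  ultimately have "finite (\<Gamma> \<inter> Q)"
    using \<Gamma> by (intro finite_discrete_subgroup_Int_compact)
  moreover have "{g\<in>\<Gamma>. norm (\<mu> g) \<le> R} \<subseteq> \<Gamma> \<inter> Q"
  proof
    fix g assume g: "g \<in> {g\<in>\<Gamma>. norm (\<mu> g) \<le> R}"
    then have "\<mu> g \<in> W" "g \<in> {a ** matrix_exp (\<mu> g) ** b | a b. a \<in> K \<and> b \<in> K}"
      using \<mu> \<Gamma>(3) unfolding is_cartan_projection_def by blast+
    then show "g \<in> \<Gamma> \<inter> Q" using g unfolding Q_def by force
  qed
  ultimately show ?thesis by (rule finite_subset[rotated])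
qed

section \<open>The growth indicator against a single linear form\<close>

lemma growth_indicator_le:
  fixes \<aa> \<Gamma> :: "(real^'n^'n) set"
  assumes \<aa>: "subspace \<aa>" and N: "norm_on \<aa> N" and f: "linear f"
    and \<Gamma>: "infinite \<Gamma>" and proper: "\<And>R. finite {g\<in>\<Gamma>. norm (\<mu> g) \<le> R}"
    and pos: "\<And>g. g \<in> \<Gamma> \<Longrightarrow> f (\<mu> g) \<ge> 0"
    and fin: "critical_exponent \<mu> \<Gamma> f < \<infinity>" and v: "v \<in> \<aa>"
  shows "growth_indicator \<aa> N \<mu> \<Gamma> v \<le> critical_exponent \<mu> \<Gamma> f * ereal (f v)"
proof (cases "v = 0")
  case True
  then show ?thesis using linear_0[OF f] by (simp add: growth_indicator_def flip: zero_ereal_def)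
next
  case v0: False
  then have Nv: "N v > 0" using N v unfolding norm_on_def by (metis less_eq_real_def)
  let ?I = "INF C\<in>{C. open_cone_in \<aa> C \<and> v \<in> C}. abscissa {\<gamma>\<in>\<Gamma>. \<mu> \<gamma> \<in> C} (\<lambda>\<gamma>. N (\<mu> \<gamma>))"
  have gi: "growth_indicator \<aa> N \<mu> \<Gamma> v = ereal (N v) * ?I" using v0 by (simp add: growth_indicator_def)
  show ?thesis
  \<comment> \<open>Nonnegativity of \<open>f v\<close> is obtained only on the limit cone, as a
    limit of nonnegative values. Elsewhere the growth indicator is -\<infinity>, so the sign of
    \<open>f v\<close> does not matter.\<close>
  proof (cases "v \<in> limit_cone \<mu> \<Gamma>")
    case True
    then obtain t g where tg: "\<And>j::nat. t j > 0 \<and> g j \<in> \<Gamma>" "(\<lambda>j. t j *\<^sub>R \<mu> (g j)) \<longlonglongrightarrow> v"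
      unfolding limit_cone_def by auto
    have "(\<lambda>j. f (t j *\<^sub>R \<mu> (g j))) \<longlonglongrightarrow> f v"
      by (rule bounded_linear.tendsto[OF linear_conv_bounded_linear[THEN iffD1, OF f] tg(2)])
    then have fv: "f v \<ge> 0"
      by (rule LIMSEQ_le_const) (use tg(1) pos in \<open>auto simp: linear_scale[OF f] less_imp_le\<close>)
    have "critical_exponent \<mu> \<Gamma> f \<ge> 0"
      unfolding critical_exponent_def using \<Gamma> pos by (rule abscissa_nonneg)
    then obtain d where d: "critical_exponent \<mu> \<Gamma> f = ereal d"
      using fin by (cases "critical_exponent \<mu> \<Gamma> f") auto
    have "ereal (N v) * ?I \<le> ereal (d * f v)"
    proof (rule ereal_le_epsilon2)
      fix e' :: real assume e': "e' > 0"
      \<comment> \<open>Raising \<open>d\<close> by \<open>e\<close> costs \<open>e * f v\<close>,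
        and a further \<open>e\<close> makes the inequality needed for \<open>s'\<close> strict. The
        total error is \<open>e * (f v + 1)\<close>, which this choice turns into
        \<open>e'\<close>.\<close>
      define e where "e = e' / (f v + 1)"
      have e: "e > 0" using e' fv by (simp add: e_def)
      define s' where "s' = ((d + e) * f v + e) / N v"
      have s': "N v * s' = (d + e) * f v + e" using Nv by (simp add: s'_def)
      have "?I \<le> ereal s'"
      proof (rule abscissa_in_cone_le[where m = \<mu> and S = \<Gamma>, OF \<aa> N f v v0 _ pos])
        show "abscissa \<Gamma> (\<lambda>x. f (\<mu> x)) < ereal (d + e)"
          using d e by (simp add: critical_exponent_def)
        show "(d + e) * f v < s' * N v" using s' e by (simp add: mult.commute)
      qed
      then have "ereal (N v) * ?I \<le> ereal (N v) * ereal s'"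
        using Nv by (intro ereal_mult_left_mono) auto
      also have "\<dots> = ereal (d * f v + e * (f v + 1))" using s' by (simp add: algebra_simps)
      also have "e * (f v + 1) = e'" using fv by (simp add: e_def)
      finally show "ereal (N v) * ?I \<le> ereal (d * f v) + ereal e'" by simp
    qed
    then show ?thesis using gi d by simp
  next
    case False
    obtain C where C: "open_cone_in \<aa> C" "v \<in> C" "finite {x\<in>\<Gamma>. \<mu> x \<in> C}"
      by (rule finite_cone_outside_limit[OF \<aa> v v0 proper])
        (use False in \<open>unfold limit_cone_def, blast\<close>)
    then have "?I \<le> abscissa {x\<in>\<Gamma>. \<mu> x \<in> C} (\<lambda>\<gamma>. N (\<mu> \<gamma>))"
      by (intro INF_lower) auto
    then have "?I = - \<infinity>" using abscissa_finite[OF C(3)] by simp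
    then show ?thesis using gi Nv by simp
  qed
qed

text \<open>If the inequality failed at every nonzero \<open>v\<close> of the limit cone, each
  direction would have a cone of convergence at an exponent below \<open>d\<close>, and compactness
  would contradict \<open>d\<close> being the abscissa over \<Gamma>.\<close>

lemma growth_indicator_ge_in_limit_cone:
  fixes \<aa> \<Gamma> :: "(real^'n^'n) set"
  assumes \<aa>: "subspace \<aa>" and N: "norm_on \<aa> N" and f: "linear f"
    and \<Gamma>: "infinite \<Gamma>" and proper: "\<And>R. finite {g\<in>\<Gamma>. norm (\<mu> g) \<le> R}"
    and pos: "\<And>g. g \<in> \<Gamma> \<Longrightarrow> f (\<mu> g) \<ge> 0" and \<mu>: "\<And>g. g \<in> \<Gamma> \<Longrightarrow> \<mu> g \<in> \<aa>"
    and fin: "critical_exponent \<mu> \<Gamma> f < \<infinity>"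
  shows "\<exists>v\<in>\<aa> \<inter> limit_cone \<mu> \<Gamma> - {0}. critical_exponent \<mu> \<Gamma> f * ereal (f v) \<le> growth_indicator \<aa> N \<mu> \<Gamma> v"
proof (rule ccontr)
  assume contra: "\<not> ?thesis"
  have "critical_exponent \<mu> \<Gamma> f \<ge> 0"
    unfolding critical_exponent_def using \<Gamma> pos by (rule abscissa_nonneg)
  then obtain d where d: "critical_exponent \<mu> \<Gamma> f = ereal d"
    using fin by (cases "critical_exponent \<mu> \<Gamma> f") auto
  have "\<exists>s<d. (\<lambda>x. exp (- s * f (\<mu> x))) summable_on \<Gamma>"
  proof (rule summable_if_locally_summable[where m = \<mu> and f = f, OF \<aa> \<mu> pos])
    show "finite {x\<in>\<Gamma>. \<mu> x = 0}" using proper[of 0] by simp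
    fix v assume v: "v \<in> \<aa>" "v \<noteq> 0"
    show "\<exists>C s. open_cone_in \<aa> C \<and> v \<in> C \<and> s < d \<and>
          (\<lambda>x. exp (- s * f (\<mu> x))) summable_on {x\<in>\<Gamma>. \<mu> x \<in> C}"
    proof (cases "v \<in> limit_cone \<mu> \<Gamma>")
      case True
      then have lt: "growth_indicator \<aa> N \<mu> \<Gamma> v < ereal (d * f v)"
        using contra v d by (auto simp: not_le)
      obtain C s where "open_cone_in \<aa> C" "v \<in> C" "s < d"
          "(\<lambda>x. exp (- s * f (\<mu> x))) summable_on {x\<in>\<Gamma>. \<mu> x \<in> C}"
        by (rule summable_in_cone[OF \<aa> N f v]) (use lt v in \<open>simp_all add: growth_indicator_def\<close>)
      then show ?thesis by blast
    next
      case False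
      obtain C where C: "open_cone_in \<aa> C" "v \<in> C" "finite {x\<in>\<Gamma>. \<mu> x \<in> C}"
        by (rule finite_cone_outside_limit[OF \<aa> v proper])
          (use False in \<open>unfold limit_cone_def, blast\<close>)
      then show ?thesis by (intro exI[of _ C] exI[of _ "d - 1"]) auto
    qed
  qed
  then obtain s where "s < d" "abscissa \<Gamma> (\<lambda>x. f (\<mu> x)) \<le> ereal s"
    using abscissa_le[of _ "\<lambda>x. f (\<mu> x)"] by blast
  then show False using d by (simp add: critical_exponent_def)
qed

section \<open>From one linear form to the minimum over the simple roots\<close>

theorem theorem1p2:
  fixes G K \<kk> \<pp> \<aa> W \<Gamma> :: "(real^'n^'n) set"
    and \<mu> :: "real^'n^'n \<Rightarrow> real^'n^'n"
    and \<alpha> :: "nat \<Rightarrow> real^'n^'n \<Rightarrow> real"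
    and N :: "real^'n^'n \<Rightarrow> real"
    and k :: nat
  assumes "connected_semisimple_real_algebraic_group G"
    and "cartan_decomposition (lie_algebra G) \<kk> \<pp>"
    and "maximal_compact_subgroup G K" and "lie_algebra K = \<kk>"
    and "maximal_abelian_in \<pp> \<aa>"
    and "closed_weyl_chamber (lie_algebra G) \<aa> W"
    and "k = dim \<aa>" and "k \<ge> 1"
    and "bij_betw \<alpha> {1..k} (simple_roots (lie_algebra G) \<aa> W)"
    and "is_cartan_projection G K W \<mu>"
    and "norm_on \<aa> N"
    and "subgroup \<Gamma> GL" and "discrete \<Gamma>" and "Zariski_dense_in \<Gamma> G"
    and "(MIN i\<in>{1..k}. critical_exponent \<mu> \<Gamma> (\<alpha> i)) < \<infinity>"
  shows "(\<forall>v\<in>\<aa>. growth_indicator \<aa> N \<mu> \<Gamma> v \<le> tent_function k \<alpha> \<mu> \<Gamma> v) \<and>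
    (\<forall>i\<in>{1..k}. critical_exponent \<mu> \<Gamma> (\<alpha> i) < \<infinity> \<longrightarrow>
       (\<exists>v\<in>limit_cone \<mu> \<Gamma> - {0}.
          growth_indicator \<aa> N \<mu> \<Gamma> v = tent_function k \<alpha> \<mu> \<Gamma> v \<and>
          tent_function k \<alpha> \<mu> \<Gamma> v = critical_exponent \<mu> \<Gamma> (\<alpha> i) * ereal (\<alpha> i v)))"
proof -
  obtain H where H: "algebraic_subgroup H" "G = connected_component_set H (mat 1)"
    using assms(1) unfolding connected_semisimple_real_algebraic_group_def by blast
  have inv: "invertible A" if "A \<in> G" for A
    using H that connected_component_subset[of H "mat 1"] unfolding algebraic_subgroup_def by blast
  have \<aa>: "subspace \<aa>" "\<aa> \<subseteq> \<pp>"
    using assms(5) unfolding maximal_abelian_in_def abelian_subspace_def by auto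
  have "\<pp> \<subseteq> lie_algebra G"
  proof
    fix X assume "X \<in> \<pp>"
    moreover have "0 \<in> \<kk>" "lie_algebra G = {X + Y | X Y. X \<in> \<kk> \<and> Y \<in> \<pp>}"
      using assms(2) subspace_0 unfolding cartan_decomposition_def by auto
    ultimately show "X \<in> lie_algebra G" by force
  qed
  then have \<aa>G: "\<aa> \<subseteq> lie_algebra G" using \<aa>(2) by blast
  have K: "subgroup K GL" "compact K"
    using assms(3) unfolding maximal_compact_subgroup_def by auto
  have root: "\<alpha> i \<in> positive_roots (lie_algebra G) \<aa> W" if "i \<in> {1..k}" for i
    using assms(9) that unfolding bij_betw_def simple_roots_def by blast
  \<comment> \<open>Positive rank provides at least one root, from which the chamber, and then
    \<Gamma>, is seen to be infinite.\<close>
  then have root1: "\<alpha> 1 \<in> restricted_roots (lie_algebra G) \<aa>"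
    using assms(8) unfolding positive_roots_def by simp
  have W: "infinite W" "W \<subseteq> \<aa>"
    using infinite_weyl_chamber[OF \<aa>(1) root1 assms(6)] weyl_chamber_subset[OF \<aa>(1) assms(6)] by auto
  have WG: "W \<subseteq> lie_algebra G" using W(2) \<aa>G by blast
  have \<Gamma>G: "\<Gamma> \<subseteq> G" using assms(14) unfolding Zariski_dense_in_def by blast
  have \<mu>: "\<mu> g \<in> W" if "g \<in> \<Gamma>" for g
    using assms(10) that \<Gamma>G unfolding is_cartan_projection_def by blast
  have "mat 1 \<in> K" using subgroup.one_closed[OF K(1)] by (simp add: GL_def)
  then have inf: "infinite \<Gamma>"
    using infinite_if_Zariski_dense[OF assms(10) _ WG W(1) assms(14)] by blast
  have "closed W" using assms(6) unfolding closed_weyl_chamber_def by auto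
  then have proper: "finite {g\<in>\<Gamma>. norm (\<mu> g) \<le> R}" for R
    using cartan_projection_proper[OF assms(10) K _ WG inv assms(12,13) \<Gamma>G] by blast
  \<comment> \<open>Each \<alpha> is \<open>undefined\<close> outside \<aa>, so it is replaced by a
    linear form on all matrices agreeing with it on \<aa>. Since \<mu> maps \<Gamma> into \<aa>, the
    critical exponents do not change.\<close>
  have "\<exists>f. linear f \<and> (\<forall>v\<in>\<aa>. \<alpha> i v = f v)" if "i \<in> {1..k}" for i
    using root[OF that] unfolding positive_roots_def restricted_roots_def by auto
  then obtain f where "\<forall>i\<in>{1..k}. linear (f i) \<and> (\<forall>v\<in>\<aa>. \<alpha> i v = f i v)"
    by metis
  then have f: "linear (f i)" "\<And>v. v \<in> \<aa> \<Longrightarrow> \<alpha> i v = f i v" if "i \<in> {1..k}" for i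
    using that by auto
  have pos: "f i (\<mu> g) \<ge> 0" if "i \<in> {1..k}" "g \<in> \<Gamma>" for i g
  proof -
    have "\<alpha> i (\<mu> g) \<ge> 0" using root[OF that(1)] \<mu>[OF that(2)] unfolding positive_roots_def by blast
    then show ?thesis using f(2)[OF that(1)] \<mu>[OF that(2)] W(2) by auto
  qed
  have ce: "critical_exponent \<mu> \<Gamma> (\<alpha> i) = critical_exponent \<mu> \<Gamma> (f i)" if "i \<in> {1..k}" for i
  proof -
    have "(\<lambda>\<gamma>. exp (- s * \<alpha> i (\<mu> \<gamma>))) summable_on \<Gamma> \<longleftrightarrow> (\<lambda>\<gamma>. exp (- s * f i (\<mu> \<gamma>))) summable_on \<Gamma>" for s
      by (rule summable_on_cong) (use f(2)[OF that] \<mu> W(2) in \<open>simp add: subset_iff\<close>)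
    then show ?thesis by (simp add: critical_exponent_def abscissa_def)
  qed
  let ?F = "{i\<in>{1..k}. critical_exponent \<mu> \<Gamma> (\<alpha> i) < \<infinity>}"
  have upper: "growth_indicator \<aa> N \<mu> \<Gamma> v \<le> tent_function k \<alpha> \<mu> \<Gamma> v" if v: "v \<in> \<aa>" for v
  proof -
    \<comment> \<open>\<open>Min\<close> is only meaningful on nonempty sets: \<open>k\<close> \<ge>
      1 gives this for the minimum in the hypothesis, whose finiteness then gives it for the one
      defining the tent function.\<close>
    have "?F \<noteq> {}"
      using assms(8,15) by (subst (asm) Min_less_iff) auto
    moreover have "growth_indicator \<aa> N \<mu> \<Gamma> v \<le> critical_exponent \<mu> \<Gamma> (\<alpha> i) * ereal (\<alpha> i v)"
      if "i \<in> ?F" for i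
    proof -
      have i: "i \<in> {1..k}" "critical_exponent \<mu> \<Gamma> (f i) < \<infinity>" using that ce by auto
      show ?thesis
        using growth_indicator_le[OF \<aa>(1) assms(11) f(1)[OF i(1)] inf proper pos[OF i(1)] i(2) v]
          f(2)[OF i(1) v] ce[OF i(1)] by simp
    qed
    ultimately show ?thesis
      unfolding tent_function_def by (intro Min.boundedI) auto
  qed
  have "\<exists>v\<in>limit_cone \<mu> \<Gamma> - {0}.
          growth_indicator \<aa> N \<mu> \<Gamma> v = tent_function k \<alpha> \<mu> \<Gamma> v \<and>
          tent_function k \<alpha> \<mu> \<Gamma> v = critical_exponent \<mu> \<Gamma> (\<alpha> i) * ereal (\<alpha> i v)"
    if i: "i \<in> {1..k}" "critical_exponent \<mu> \<Gamma> (\<alpha> i) < \<infinity>" for i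
  proof -
    have \<mu>\<aa>: "\<mu> g \<in> \<aa>" if "g \<in> \<Gamma>" for g using \<mu>[OF that] W(2) by blast
    obtain v where v: "v \<in> \<aa>" "v \<in> limit_cone \<mu> \<Gamma> - {0}"
      "critical_exponent \<mu> \<Gamma> (f i) * ereal (f i v) \<le> growth_indicator \<aa> N \<mu> \<Gamma> v"
      using growth_indicator_ge_in_limit_cone[OF \<aa>(1) assms(11) f(1)[OF i(1)] inf proper pos[OF i(1)] \<mu>\<aa>]
        i(2) ce[OF i(1)] by auto
    \<comment> \<open>The value of the \<open>i\<close>-th form at \<open>v\<close> lies below the
      growth indicator, which lies below the tent function, which lies below that same value. All
      three therefore coincide.\<close>
    have "tent_function k \<alpha> \<mu> \<Gamma> v \<le> critical_exponent \<mu> \<Gamma> (\<alpha> i) * ereal (\<alpha> i v)"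
      unfolding tent_function_def using i by (intro Min_le) auto
    moreover have "critical_exponent \<mu> \<Gamma> (\<alpha> i) * ereal (\<alpha> i v) \<le> growth_indicator \<aa> N \<mu> \<Gamma> v"
      using v(1,3) f(2)[OF i(1)] ce[OF i(1)] by simp
    ultimately show ?thesis
      using upper[OF v(1)] v(2) by (intro bexI[of _ v]) (auto intro: antisym)
  qed
  then show ?thesis using upper by blast
qed

end
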